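(* Let $\alpha, x \in \mathbb{R}$ and let $n \ge 0$ be an integer. For each integer $m\ge 0$ put $$\gamma_{m}=\sum_{i=0}^{m}\langle \alpha\rangle_{i}\,\frac{m!}{(m+i)!}\sum_{j=0}^{i}(-1)^{i-j}\binom{m+i}{i-j}S(m+j,j).$$ Then the higher-order Bernoulli polynomial $B_n^{(\alpha)}(x)$ is given by the $(n+1)\times(n+1)$ determinant $$B_{n}^{(\alpha)}(x)=(-1)^{n}\begin{vmatrix} 1 & \gamma_{0} & 0 & \cdots & 0 & 0\\ x & \gamma_{1} & \gamma_{0} & \cdots & 0 & 0\\ x^{2} & \gamma_{2} & \binom{2}{1}\gamma_{1} & \cdots & 0 & 0\\ \vdots & \vdots & \vdots & \ddots & \vdots & \vdots\\ x^{n-2} & \gamma_{n-2} & \binom{n-2}{1}\gamma_{n-3} & \cdots & \gamma_{0} & 0\\ x^{n-1} & \gamma_{n-1} & \binom{n-1}{1}\gamma_{n-2} & \cdots & \binom{n-1}{n-2}\gamma_{1} & \gamma_{0}\\ x^{n} & \gamma_{n} & \binom{n}{1}\gamma_{n-1} & \cdots & \binom{n}{n-2}\gamma_{2} & \binom{n}{n-1}\gamma_{1} \end{vmatrix},$$ that is, the determinant of the matrix whose first column has entries $x^{r-1}$ ($1\le r\le n+1$) and whose $(c+1)$-st column, for $1\le c\le n$, has $r$-th entry $\binom{r-1}{c-1}\gamma_{r-c}$ if $r\ge c$ and $0$ if $r<c$.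
   Context: The higher-order Bernoulli polynomials $B_n^{(\alpha)}(x)$ are defined by the generating function $$\left(\frac{t}{e^{t}-1}\right)^{\alpha}e^{xt}=\sum_{n=0}^{\infty}B_n^{(\alpha)}(x)\frac{t^n}{n!}$$ for $t$ near $0$, where $t/(e^t-1)$ is taken to be $1$ at $t=0$ and the power is the branch equal to $1$ at $t=0$. The falling factorial is $\langle y\rangle_0=1$ and $\langle y\rangle_m=y(y-1)\cdots(y-m+1)$ for $m\ge1$, $y\in\mathbb{R}$. $S(n,k)$ denotes the Stirling numbers of the second kind, defined by $\frac{(e^t-1)^k}{k!}=\sum_{n=k}^{\infty}S(n,k)\frac{t^n}{n!}$ (so $S(0,0)=1$ and $S(n,0)=0$ for $n\ge1$). The convention $x^0=1$ (also for $x=0$) is used. *)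

theory Defs
  imports
    "HOL-Complex_Analysis.Laurent_Convergence"
    "HOL-Combinatorics.Stirling"
    "Jordan_Normal_Form.Determinant"
begin

definition todd :: "real \<Rightarrow> real"
  where "todd t = (if t = 0 then 1 else t / (exp t - 1))"

text \<open>
  Since \<open>todd t > 0\<close> for every real \<open>t\<close>, the real power \<open>todd t powr \<alpha>\<close> is the branch
  that equals \<open>1\<close> at \<open>t = 0\<close>.
\<close>

definition is_bernoulli_seq :: "real \<Rightarrow> real \<Rightarrow> (nat \<Rightarrow> real) \<Rightarrow> bool"
  where "is_bernoulli_seq \<alpha> x b \<longleftrightarrow>
    (\<forall>\<^sub>F t in nhds 0. (\<lambda>n. b n * t ^ n / fact n) sums (todd t powr \<alpha> * exp (x * t)))"

text \<open>\<open>bernpoly_ho \<alpha> n x\<close> is $B_n^{(\alpha)}(x)$.\<close>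

definition bernpoly_ho :: "real \<Rightarrow> nat \<Rightarrow> real \<Rightarrow> real"
  where "bernpoly_ho \<alpha> n x = (THE b. is_bernoulli_seq \<alpha> x b) n"

definition falling_factorial :: "real \<Rightarrow> nat \<Rightarrow> real"
  where "falling_factorial y m = (\<Prod>k<m. y - real k)"

definition bern_gamma :: "real \<Rightarrow> nat \<Rightarrow> real"
  where "bern_gamma \<alpha> m =
    (\<Sum>i=0..m. falling_factorial \<alpha> i * (fact m / fact (m + i)) *
      (\<Sum>j=0..i. (- 1) ^ (i - j) * real ((m + i) choose (i - j)) * real (Stirling (m + j) j)))"

text \<open>Rows and columns are indexed from \<open>0\<close>. With rows counted from \<open>1\<close>, the entry in row
  \<open>r\<close> of a column \<open>c \<ge> 1\<close> is $\binom{r-1}{c-1}\gamma_{r-c}$ for \<open>r \<ge> c\<close>.\<close>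

definition bern_matrix :: "real \<Rightarrow> real \<Rightarrow> nat \<Rightarrow> real mat"
  where "bern_matrix \<alpha> x n = Matrix.mat (n + 1) (n + 1) (\<lambda>(r, c).
    if c = 0 then x ^ r
    else if c \<le> r + 1 then real (r choose (c - 1)) * bern_gamma \<alpha> (r + 1 - c)
    else 0)"

text \<open>The generating function determines its coefficients, so the definite description in
  \<open>bernpoly_ho\<close> is not a default value.\<close>

lemma is_bernoulli_seq_unique:
  assumes "is_bernoulli_seq \<alpha> x b" "is_bernoulli_seq \<alpha> x c"
  shows "b = c"
proof (rule ccontr)
  assume "b \<noteq> c"
  then obtain m where m: "b m \<noteq> c m"
    by auto
  have "\<forall>\<^sub>F t in nhds 0. (\<lambda>n. (b n - c n) / fact n * t ^ n) sums 0"
    using assms unfolding is_bernoulli_seq_def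
  proof eventually_elim
    case (elim t)
    from sums_diff[OF elim] show ?case
      by (simp add: field_simps)
  qed
  then obtain e where e: "e > 0"
    and sums: "\<And>t. \<bar>t\<bar> < e \<Longrightarrow> (\<lambda>n. (b n - c n) / fact n * t ^ n) sums 0"
    by (auto simp: eventually_nhds_metric dist_norm)
  have "(b 0 - c 0) / fact 0 = 0"
    using sums[of 0] e powser_sums_zero_iff[of "\<lambda>n. (b n - c n) / fact n" 0] by simp
  then have "m > 0"
    using m by (cases m) auto
  then obtain s where "0 < s" and "\<And>z::real. z \<in> cball 0 s - {0} \<Longrightarrow> (\<lambda>_. 0 :: real) z \<noteq> 0"
    using powser_0_nonzero[of e 0 "\<lambda>n. (b n - c n) / fact n" "\<lambda>_. 0" m] e sums m by auto
  from this(2)[of s] \<open>0 < s\<close> show False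
    by simp
qed

lemma is_bernoulli_seq_exists: "\<exists>b. is_bernoulli_seq \<alpha> x b"
proof -
  define g where "g = (\<lambda>t::complex. if t = 0 then 1 else (exp t - 1) / t)"
  define f where "f = (\<lambda>t::complex. (1 + (g t - 1)) powr (- of_real \<alpha>) * exp (of_real x * t))"
  define G where "G = fps_shift 1 (fps_exp 1 - 1 :: complex fps)"
  have G0: "fps_nth G 0 = 1"
    by (simp add: G_def)
  have "fps_nth (fps_exp 1 :: complex fps) 1 \<noteq> fps_nth 1 1"
    by simp
  then have neq: "fps_exp 1 \<noteq> (1 :: complex fps)"
    by metis
  have "g has_fps_expansion G"
    unfolding g_def G_def
    by (rule has_fps_expansion_shift[where n = 1, unfolded power_one_right])
      (auto intro!: fps_expansion_intros subdegree_geI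
        simp: neq)
  then have "f has_fps_expansion
      (fps_compose (fps_binomial (- of_real \<alpha>)) (G - 1) * fps_exp (of_real x))"
    (is "_ has_fps_expansion ?F") unfolding f_def
    by (intro has_fps_expansion_mult has_fps_expansion_exp
        has_fps_expansion_compose[unfolded o_def, OF has_fps_expansion_binomial_complex]
        has_fps_expansion_diff has_fps_expansion_1) (auto simp: G0)
  then obtain e where e: "e > 0"
    and sums: "\<And>z. norm z < e \<Longrightarrow> (\<lambda>n. fps_nth ?F n * z ^ n) sums f z"
  proof -
    assume F: "f has_fps_expansion ?F"
    then have "\<forall>\<^sub>F z in nhds 0. z \<in> eball 0 (fps_conv_radius ?F)"
      by (intro eventually_nhds_in_open) (auto simp: has_fps_expansion_def zero_ereal_def)
    moreover have "\<forall>\<^sub>F z in nhds 0. eval_fps ?F z = f z"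
      using F by (auto simp: has_fps_expansion_def)
    ultimately have "\<forall>\<^sub>F z in nhds 0. (\<lambda>n. fps_nth ?F n * z ^ n) sums f z"
      by eventually_elim (use sums_eval_fps in \<open>fastforce simp: in_eball_iff\<close>)
    then show ?thesis
      using that by (auto simp: eventually_nhds_metric)
  qed
  have f_real: "f (of_real t) = of_real (todd t powr \<alpha> * exp (x * t))" for t
  proof (cases "t = 0")
    case False
    then have pos: "todd t > 0"
      by (cases "t > 0") (auto simp: todd_def divide_neg_neg)
    have "g (of_real t) = of_real (inverse (todd t))"
      using False by (simp add: g_def todd_def flip: exp_of_real)
    then have "f (of_real t) = of_real (inverse (todd t) powr (- \<alpha>)) * exp (of_real (x * t))"
      using pos by (simp add: f_def powr_of_real[symmetric])
    also have "inverse (todd t) powr (- \<alpha>) = todd t powr \<alpha>"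
      using pos by (simp add: powr_minus powr_def ln_inverse)
    finally show ?thesis
      by (simp flip: exp_of_real)
  qed (auto simp: f_def g_def todd_def)
  have "(\<lambda>n. Re (fps_nth ?F n) * fact n * t ^ n / fact n) sums (todd t powr \<alpha> * exp (x * t))"
    if "\<bar>t\<bar> < e" for t
  proof -
    have "(\<lambda>n. Re (fps_nth ?F n * of_real t ^ n)) sums Re (f (of_real t))"
      using that by (intro sums_Re sums) auto
    then show ?thesis
      by (simp add: f_real flip: of_real_power)
  qed
  then have "is_bernoulli_seq \<alpha> x (\<lambda>n. Re (fps_nth ?F n) * fact n)"
    unfolding is_bernoulli_seq_def eventually_nhds_metric using e by (auto simp: dist_norm)
  then show ?thesis
    by blast
qed

lemma is_bernoulli_seq_bernpoly_ho: "is_bernoulli_seq \<alpha> x (\<lambda>n. bernpoly_ho \<alpha> n x)"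
  unfolding bernpoly_ho_def
  using is_bernoulli_seq_exists is_bernoulli_seq_unique by (metis theI)

end

theory Submission
  imports Defs
begin

text \<open>
  Writing $((e^t-1)/t)^\alpha = (1 + ((e^t-1)/t - 1))^\alpha$ and expanding by the binomial series
  shows that the numbers $\gamma_m$ have exponential generating function $((e^t-1)/t)^\alpha$.
  Multiplying by the generating function of $B_n^{(\alpha)}(x)$ leaves $e^{xt}$, that is,
  $\sum_k \binom{r}{k} \gamma_{r-k} B_k^{(\alpha)}(x) = x^r$. This is a unitriangular linear system
  for the Bernoulli polynomials, and the determinant is Cramer's rule for its last unknown.
\<close>

lemma has_fps_expansion_imp_eventually_sums:
  fixes F :: "'a :: {banach, real_normed_div_algebra} fps"
  assumes "f has_fps_expansion F"
  shows "\<forall>\<^sub>F z in nhds 0. (\<lambda>n. fps_nth F n * z ^ n) sums f z"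
proof -
  have "\<forall>\<^sub>F z in nhds 0. z \<in> eball 0 (fps_conv_radius F)"
    using assms by (intro eventually_nhds_in_open) (auto simp: has_fps_expansion_def zero_ereal_def)
  moreover have "\<forall>\<^sub>F z in nhds 0. eval_fps F z = f z"
    using assms by (auto simp: has_fps_expansion_def)
  ultimately show ?thesis
    by eventually_elim (use sums_eval_fps in \<open>fastforce simp: in_eball_iff\<close>)
qed

text \<open>Moves from convergent sums near 0 to formal power series, where products of generating
  functions become Cauchy products of coefficients.\<close>

lemma is_bernoulli_seq_iff_has_fps_expansion:
  "is_bernoulli_seq \<alpha> x b \<longleftrightarrow>
    (\<lambda>t. todd t powr \<alpha> * exp (x * t)) has_fps_expansion Abs_fps (\<lambda>n. b n / fact n)"
  unfolding is_bernoulli_seq_def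
  using has_fps_expansion_imp_eventually_sums[of "\<lambda>t. todd t powr \<alpha> * exp (x * t)"
      "Abs_fps (\<lambda>n. b n / fact n)"]
    has_fps_expansionI[of "Abs_fps (\<lambda>n. b n / fact n)" "\<lambda>t. todd t powr \<alpha> * exp (x * t)"]
  by auto

lemma todd_pos: "todd t > 0"
  by (cases t "0 :: real" rule: linorder_cases) (auto simp: todd_def divide_neg_neg)

text \<open>Multiplying generating functions adds both parameters, and the Cauchy product of
  exponential series is the binomial convolution.\<close>

lemma is_bernoulli_seq_convolution:
  assumes "is_bernoulli_seq \<alpha> x b" "is_bernoulli_seq \<beta> y c"
  shows "is_bernoulli_seq (\<alpha> + \<beta>) (x + y) (\<lambda>n. \<Sum>k\<le>n. real (n choose k) * b k * c (n - k))"
proof -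
  have "(\<lambda>t. (todd t powr \<alpha> * exp (x * t)) * (todd t powr \<beta> * exp (y * t))) has_fps_expansion
      Abs_fps (\<lambda>n. b n / fact n) * Abs_fps (\<lambda>n. c n / fact n)"
    using assms unfolding is_bernoulli_seq_iff_has_fps_expansion
    by (rule has_fps_expansion_mult)
  also have "(\<lambda>t. (todd t powr \<alpha> * exp (x * t)) * (todd t powr \<beta> * exp (y * t))) =
      (\<lambda>t. todd t powr (\<alpha> + \<beta>) * exp ((x + y) * t))"
    by (simp add: powr_add ring_distribs exp_add mult_ac)
  also have "Abs_fps (\<lambda>n. b n / fact n) * Abs_fps (\<lambda>n. c n / fact n) =
      Abs_fps (\<lambda>n. (\<Sum>k\<le>n. real (n choose k) * b k * c (n - k)) / fact n)"
    by (rule fps_ext)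
      (auto simp: fps_mult_nth sum_divide_distrib binomial_fact atLeast0AtMost intro!: sum.cong)
  finally show ?thesis
    by (simp add: is_bernoulli_seq_iff_has_fps_expansion)
qed

lemma is_bernoulli_seq_0: "is_bernoulli_seq 0 x (\<lambda>n. x ^ n)"
proof -
  \<comment> \<open>\<open>powr\<close> returns 0 at base 0 even for exponent 0, so
    \<open>todd t powr 0 = 1\<close> requires a nonzero base.\<close>
  have "todd t \<noteq> 0" for t
    using todd_pos[of t] by simp
  moreover have "fps_exp x = Abs_fps (\<lambda>n. x ^ n / fact n)"
    by (simp add: fps_exp_def)
  ultimately show ?thesis
    using has_fps_expansion_exp[of x] by (simp add: is_bernoulli_seq_iff_has_fps_expansion)
qed

text \<open>With E = e^t - 1 one has E' = E + 1, so the derivative of E^(k+1) is (k+1)(E^(k+1) +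
  E^k). Comparing coefficients gives exactly the recursion of \<open>Stirling\<close>.\<close>

lemma fps_exp_minus_1_power_nth:
  "fps_nth ((fps_exp 1 - 1 :: 'a :: field_char_0 fps) ^ k) n =
    fact k * of_nat (Stirling n k) / fact n"
proof (induction n k rule: Stirling.induct)
  case (4 n k)
  let ?E = "fps_exp 1 - 1 :: 'a fps"
  have "fps_deriv (?E ^ Suc k) = fps_const (of_nat (Suc k)) * ((?E + 1) * ?E ^ k)"
    unfolding fps_deriv_power by (simp add: mult_ac)
  also have "(?E + 1) * ?E ^ k = ?E ^ Suc k + ?E ^ k"
    by (simp only: distrib_right power_Suc mult_1_left)
  finally have "of_nat (Suc n) * fps_nth (?E ^ Suc k) (Suc n) =
      of_nat (Suc k) * (fps_nth (?E ^ Suc k) n + fps_nth (?E ^ k) n)"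
    by (metis Suc_eq_plus1 fps_add_nth fps_deriv_nth fps_mult_left_const_nth)
  also have "\<dots> = fact (Suc k) * of_nat (Stirling (Suc n) (Suc k)) / fact n"
    unfolding 4 by (simp add: field_simps)
  finally show ?case
    by (simp add: field_simps del: Stirling.simps power_Suc of_nat_Suc)
qed auto

text \<open>The left side is the formal power of (e^t - 1)/t with exponent \<alpha>. The outer sum
  of \<open>bern_gamma\<close> comes from the binomial series in \<open>G - 1\<close>, the inner one
  from expanding \<open>(G - 1) ^ i\<close> in powers of \<open>G\<close>. As \<open>G - 1\<close>
  has no constant term, only i up to m contributes.\<close>

lemma bern_gamma_eq_fps_nth:
  defines "G \<equiv> fps_shift 1 (fps_exp 1 - 1 :: complex fps)"
  shows "fps_nth (fps_compose (fps_binomial (of_real \<alpha>)) (G - 1)) m =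
    of_real (bern_gamma \<alpha> m / fact m)"
proof -
  have shift: "fps_X * G = fps_exp 1 - 1"
    unfolding G_def by (intro fps_ext) (simp add: fps_X_mult_nth)
  have G_power: "fps_nth (G ^ j) m = fact j * of_nat (Stirling (m + j) j) / fact (m + j)" for j
  proof -
    \<comment> \<open>Restoring the factor t^j turns the power of \<open>G\<close> into one of e^t -
      1, at the cost of raising the index by \<open>j\<close>.\<close>
    have "fps_nth (G ^ j) m = fps_nth (fps_X ^ j * G ^ j) (m + j)"
      by (simp add: fps_X_power_mult_nth)
    also have "fps_X ^ j * G ^ j = (fps_exp 1 - 1) ^ j"
      by (simp flip: shift add: power_mult_distrib)
    finally show ?thesis
      by (simp add: fps_exp_minus_1_power_nth)
  qed
  have "fps_nth ((G - 1) ^ i) m = of_real (fact i / fact (m + i) *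
      (\<Sum>j=0..i. (-1) ^ (i - j) * real ((m + i) choose (i - j)) * real (Stirling (m + j) j)))" for i
  proof -
    have "(G - 1) ^ i = (\<Sum>j\<le>i. of_nat (i choose j) * G ^ j * (-1) ^ (i - j))"
      using binomial_ring[of G "-1" i] by simp
    also have "\<dots> = (\<Sum>j\<le>i. fps_const (of_nat (i choose j) * (-1) ^ (i - j)) * G ^ j)"
      by (intro sum.cong refl) (simp add: fps_of_nat fps_const_power mult_ac
          flip: fps_const_mult fps_const_power fps_const_neg)
    finally have "fps_nth ((G - 1) ^ i) m = (\<Sum>j\<le>i. of_nat (i choose j) * (-1) ^ (i - j) *
        (fact j * of_nat (Stirling (m + j) j) / fact (m + j)))"
      by (simp add: fps_sum_nth G_power)
    also have "\<dots> = (\<Sum>j\<le>i. fact i / fact (m + i) *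
        ((-1) ^ (i - j) * of_nat ((m + i) choose (i - j)) * of_nat (Stirling (m + j) j)))"
    \<comment> \<open>Termwise, both factorial quotients reduce to i! / ((i-j)! (m+j)!).\<close>
    proof (intro sum.cong refl)
      fix j assume "j \<in> {..i}"
      then have "of_nat (i choose j) = (fact i / (fact j * fact (i - j)) :: complex)"
        "of_nat ((m + i) choose (i - j)) = (fact (m + i) / (fact (i - j) * fact (m + j)) :: complex)"
        by (simp_all add: binomial_fact)
      then show "of_nat (i choose j) * (-1) ^ (i - j) *
          (fact j * of_nat (Stirling (m + j) j) / fact (m + j)) = (fact i / fact (m + i) *
          ((-1) ^ (i - j) * of_nat ((m + i) choose (i - j)) * of_nat (Stirling (m + j) j)) :: complex)"
        by simp
    qed
    finally show ?thesis
      by (simp add: sum_distrib_left atLeast0AtMost)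
  qed
  moreover have "complex_of_real \<alpha> gchoose i = of_real (falling_factorial \<alpha> i / fact i)" for i
    by (simp add: gbinomial_prod_rev falling_factorial_def atLeast0LessThan)
  ultimately have "fps_nth (fps_compose (fps_binomial (of_real \<alpha>)) (G - 1)) m =
      of_real (\<Sum>i=0..m. falling_factorial \<alpha> i / fact i * (fact i / fact (m + i) *
        (\<Sum>j=0..i. (-1) ^ (i - j) * real ((m + i) choose (i - j)) * real (Stirling (m + j) j))))"
    by (simp only: fps_compose_nth fps_binomial_nth flip: of_real_mult of_real_sum)
  then show ?thesis
    unfolding bern_gamma_def by (simp add: sum_divide_distrib)
qed

text \<open>The library relates composition of power series to composition of functions only over the
  complex numbers, so the expansion is established there and restricted to the real line.\<close>

lemma is_bernoulli_seq_bern_gamma: "is_bernoulli_seq (- \<alpha>) 0 (bern_gamma \<alpha>)"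
proof -
  define g where "g = (\<lambda>t::complex. if t = 0 then 1 else (exp t - 1) / t)"
  define G where "G = fps_shift 1 (fps_exp 1 - 1 :: complex fps)"
  define f where "f = (\<lambda>t. (1 + (g t - 1)) powr of_real \<alpha>)"
  define F where "F = fps_compose (fps_binomial (of_real \<alpha>)) (G - 1)"
  \<comment> \<open>The shift below needs \<open>fps_exp 1 - 1\<close> to have subdegree at least 1,
    and the bound by \<open>subdegree_geI\<close> asks for a nonzero series.\<close>
  have "fps_nth (fps_exp 1 :: complex fps) 1 \<noteq> fps_nth 1 1"
    by simp
  then have neq: "fps_exp 1 \<noteq> (1 :: complex fps)"
    by metis
  have "g has_fps_expansion G"
    unfolding g_def G_def
    by (rule has_fps_expansion_shift[where n = 1, unfolded power_one_right])
      (auto intro!: fps_expansion_intros subdegree_geI simp: neq)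
  then have "f has_fps_expansion F"
    unfolding f_def F_def
    by (intro has_fps_expansion_compose[unfolded o_def, OF has_fps_expansion_binomial_complex]
        has_fps_expansion_diff has_fps_expansion_1) (auto simp: G_def)
  then have "\<forall>\<^sub>F z in nhds 0. (\<lambda>n. fps_nth F n * z ^ n) sums f z"
    by (rule has_fps_expansion_imp_eventually_sums)
  moreover have "filterlim complex_of_real (nhds 0) (nhds 0)"
    using tendsto_of_real[OF filterlim_ident, of 0] by simp
  ultimately have "\<forall>\<^sub>F t in nhds 0. (\<lambda>n. fps_nth F n * of_real t ^ n) sums f (of_real t)"
    by (rule eventually_compose_filterlim)
  \<comment> \<open>On the real line \<open>g\<close> is the reciprocal of \<open>todd\<close>,
    which flips the sign of the exponent; positivity makes the complex and real powers
    agree.\<close>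
  moreover have "f (of_real t) = of_real (todd t powr (- \<alpha>) * exp (0 * t))" for t
  proof -
    have "g (of_real t) = of_real (inverse (todd t))"
      by (simp add: g_def todd_def flip: exp_of_real)
    then have "f (of_real t) = of_real (inverse (todd t) powr \<alpha>)"
      using todd_pos[of t] by (simp add: f_def flip: powr_of_real)
    also have "inverse (todd t) powr \<alpha> = todd t powr (- \<alpha>)"
      using todd_pos[of t] by (simp add: powr_def ln_inverse)
    finally show ?thesis
      by simp
  qed
  moreover have "fps_nth F n * of_real t ^ n = of_real (bern_gamma \<alpha> n * t ^ n / fact n)" for n t
    unfolding F_def G_def bern_gamma_eq_fps_nth by simp
  ultimately show ?thesis
    by (simp only: is_bernoulli_seq_def sums_of_real_iff)
qed

text \<open>The exponents \<alpha> and -\<alpha> cancel in the convolution, and uniqueness at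
  exponent 0 identifies the result with the powers of x.\<close>

lemma bernpoly_ho_recurrence:
  "(\<Sum>k\<le>r. real (r choose k) * bern_gamma \<alpha> (r - k) * bernpoly_ho \<alpha> k x) = x ^ r"
proof -
  have "is_bernoulli_seq 0 x
      (\<lambda>n. \<Sum>k\<le>n. real (n choose k) * bernpoly_ho \<alpha> k x * bern_gamma \<alpha> (n - k))"
    using is_bernoulli_seq_convolution[OF is_bernoulli_seq_bernpoly_ho[of \<alpha> x]
        is_bernoulli_seq_bern_gamma[of \<alpha>]] by simp
  from fun_cong[OF is_bernoulli_seq_unique[OF this is_bernoulli_seq_0], of r] show ?thesis
    by (simp add: mult_ac)
qed

lemma bern_gamma_0: "bern_gamma \<alpha> 0 = 1"
  by (simp add: bern_gamma_def falling_factorial_def)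

text \<open>In the last row only column 0 can be nonzero, since the shifted 1 would fall outside the
  matrix. Deleting that row and column leaves the identity, so the cofactor is just the
  sign.\<close>

lemma det_first_column_shift_identity:
  fixes b :: "nat \<Rightarrow> 'a :: comm_ring_1"
  shows "Determinant.det (Matrix.mat (n + 1) (n + 1)
    (\<lambda>(k, c). if c = 0 then b k else if c = k + 1 then 1 else 0)) = (- 1) ^ n * b n"
    (is "Determinant.det ?N = _")
proof -
  have "mat_delete ?N n 0 = 1\<^sub>m n"
    by (rule eq_matI) (auto simp: mat_delete_def)
  then have cofactor: "cofactor ?N n 0 = (- 1) ^ n"
    by (simp add: cofactor_def)
  have "Determinant.det ?N = (\<Sum>j<n + 1. ?N $$ (n, j) * cofactor ?N n j)"
    by (rule laplace_expansion_row) auto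
  also have "\<dots> = (\<Sum>j<n + 1. if j = 0 then b n * cofactor ?N n 0 else 0)"
    by (intro sum.cong refl) auto
  also have "\<dots> = b n * cofactor ?N n 0"
    by (subst sum.delta) auto
  finally show ?thesis
    by (simp only: cofactor mult.commute)
qed

theorem theorem4p1:
  fixes \<alpha> x :: real and n :: nat
  shows "bernpoly_ho \<alpha> n x = (- 1) ^ n * Determinant.det (bern_matrix \<alpha> x n)"
proof -
  \<comment> \<open>Cramer's rule as a factorization: \<open>L\<close> is the matrix of the linear
    system, and \<open>N\<close> has the solution vector as its first column, followed by the first
    n unit vectors.\<close>
  define L where "L = Matrix.mat (n + 1) (n + 1)
    (\<lambda>(r, k). if k \<le> r then real (r choose k) * bern_gamma \<alpha> (r - k) else 0)"
  define N where "N = Matrix.mat (n + 1) (n + 1)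
    (\<lambda>(k, c). if c = 0 then bernpoly_ho \<alpha> k x else if c = k + 1 then 1 else 0)"
  have carrier: "L \<in> carrier_mat (n + 1) (n + 1)" "N \<in> carrier_mat (n + 1) (n + 1)"
    by (auto simp: L_def N_def)
  have "bern_matrix \<alpha> x n = L * N"
  proof (rule eq_matI)
    fix r c assume "r < dim_row (L * N)" "c < dim_col (L * N)"
    then have rc: "r < n + 1" "c < n + 1"
      by (auto simp: L_def N_def)
    then have prod: "(L * N) $$ (r, c) = (\<Sum>k<n + 1. L $$ (r, k) * N $$ (k, c))"
      by (auto simp: L_def N_def scalar_prod_def atLeast0LessThan)
    show "bern_matrix \<alpha> x n $$ (r, c) = (L * N) $$ (r, c)"
    proof (cases c)
      case 0
      have "(\<Sum>k<n + 1. L $$ (r, k) * N $$ (k, c)) =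
          (\<Sum>k\<le>r. real (r choose k) * bern_gamma \<alpha> (r - k) * bernpoly_ho \<alpha> k x)"
        using rc 0 by (intro sum.mono_neutral_cong_right) (auto simp: L_def N_def)
      then show ?thesis
        using rc 0 prod by (simp add: bernpoly_ho_recurrence bern_matrix_def)
    next
      case (Suc d)
      \<comment> \<open>Column \<open>Suc d\<close> of \<open>N\<close> is the unit vector at
        \<open>d\<close>, so it selects column \<open>d\<close> of \<open>L\<close>.\<close>
      have "(\<Sum>k<n + 1. L $$ (r, k) * N $$ (k, c)) = (\<Sum>k<n + 1. if k = d then L $$ (r, d) else 0)"
        using rc Suc by (intro sum.cong refl) (auto simp: N_def)
      also have "\<dots> = L $$ (r, d)"
        using rc Suc by simp
      finally show ?thesis
        using rc Suc prod by (auto simp: L_def bern_matrix_def)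
    qed
  qed (auto simp: bern_matrix_def L_def N_def)
  moreover have "Determinant.det L = 1"
  proof -
    have "Determinant.det L = prod_list (diag_mat L)"
      by (rule det_lower_triangular[OF _ carrier(1)]) (auto simp: L_def)
    also have "diag_mat L = map (\<lambda>_. 1) [0..<n + 1]"
      by (auto simp: diag_mat_def L_def bern_gamma_0)
    finally show ?thesis
      by (simp only: map_replicate_const prod_list_replicate power_one)
  qed
  moreover have "Determinant.det N = (- 1) ^ n * bernpoly_ho \<alpha> n x"
    unfolding N_def by (rule det_first_column_shift_identity)
  \<comment> \<open>The sign from \<open>N\<close> cancels the one in the claim, since their product
    is a power of (-1)(-1) = 1.\<close>
  ultimately show ?thesis
    by (simp add: det_mult[OF carrier] flip: mult.assoc power_mult_distrib)
qed

end
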